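(* Let $a\ge 0$ be a real number, and let $G$ be a connected simple graph with $n=|V(G)|$ vertices and minimum degree $\delta=\delta(G)$. Let $k\in(0,n)$ be a real number with $\delta\le\frac{n-k}{2}$. If $$\lambda_{1}(aD(G)+A(G))<\varphi(a,n,\delta,k),$$ then $\mu_{f}(G)>\frac{n-k}{2}$.
   Context: Graphs are finite, simple and undirected. $A(G)$ is the adjacency matrix of $G$, $D(G)$ is the diagonal matrix of vertex degrees, and $\lambda_1(M)$ denotes the largest eigenvalue of a real symmetric matrix $M$. A fractional matching of $G$ is a function $f:E(G)\to[0,1]$ such that for every vertex $v$ the sum of $f(e)$ over all edges $e$ incident with $v$ is at most $1$. The fractional matching number is $\mu_f(G)=\max\{\sum_{e\in E(G)}f(e): f \text{ is a fractional matching of } G\}$. For real $a\ge 0$, real $k\in(0,n)$ and an integer $\delta\le\frac{n-k}{2}$, define $\varphi(a,n,\delta,k)=\delta\sqrt{1+\frac{2k}{n-k}}$ if $a=0$; $\varphi(a,n,\delta,k)=\frac{2a\delta n}{n-k}$ if $0<a\le 1$; $\varphi(a,n,\delta,k)=\frac{a\delta(n+k)}{n-k}$ if $a>1$. *)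

theory Defs
  imports "HOL-Analysis.Analysis"
begin

text \<open>
  The vertex set of a graph is a whole finite type, so that matrices indexed by the vertices have
  type \<open>real ^ 'v ^ 'v\<close> and the number of vertices is \<open>CARD('v)\<close>. A graph is given by its edge
  set; an edge is a two-element set of vertices, which rules out loops and multiple edges.
\<close>

definition simple_graph :: "'v::finite set set \<Rightarrow> bool" where
  "simple_graph E \<longleftrightarrow> (\<forall>e\<in>E. card e = 2)"

definition adjacent :: "'v::finite set set \<Rightarrow> 'v \<Rightarrow> 'v \<Rightarrow> bool" where
  "adjacent E u v \<longleftrightarrow> {u, v} \<in> E"

definition connected_graph :: "'v::finite set set \<Rightarrow> bool" where
  "connected_graph E \<longleftrightarrow> (\<forall>u v. (adjacent E)\<^sup>*\<^sup>* u v)"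

definition incident_edges :: "'v::finite set set \<Rightarrow> 'v \<Rightarrow> 'v set set" where
  "incident_edges E v = {e \<in> E. v \<in> e}"

definition degree :: "'v::finite set set \<Rightarrow> 'v \<Rightarrow> nat" where
  "degree E v = card (incident_edges E v)"

definition min_degree :: "'v::finite set set \<Rightarrow> nat" where
  "min_degree E = Min (range (degree E))"

definition adjacency_matrix :: "'v::finite set set \<Rightarrow> real ^ 'v ^ 'v" where
  "adjacency_matrix E = (\<chi> u v. if adjacent E u v then 1 else 0)"

definition degree_matrix :: "'v::finite set set \<Rightarrow> real ^ 'v ^ 'v" where
  "degree_matrix E = (\<chi> u v. if u = v then real (degree E u) else 0)"

definition eigenvalue :: "real ^ 'n ^ 'n \<Rightarrow> real \<Rightarrow> bool" where
  "eigenvalue M c \<longleftrightarrow> (\<exists>x. x \<noteq> 0 \<and> M *v x = c *\<^sub>R x)"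

text \<open>
  Only meaningful if the set of real eigenvalues is finite and nonempty, as it is for symmetric
  matrices; see \<open>symmetric_eigenvalues\<close> below.
\<close>

definition largest_eigenvalue :: "real ^ 'n ^ 'n \<Rightarrow> real" where
  "largest_eigenvalue M = Max {c. eigenvalue M c}"

text \<open>
  Fractional matchings are total functions here, but their values outside the edge set are
  irrelevant. The maximum in the definition of the fractional matching number ranges over an
  infinite set of values; it exists by \<open>fractional_matching_number_attained\<close> below.
\<close>

definition fractional_matching :: "'v::finite set set \<Rightarrow> ('v set \<Rightarrow> real) \<Rightarrow> bool" where
  "fractional_matching E f \<longleftrightarrow>
     (\<forall>e\<in>E. f e \<in> {0..1}) \<and> (\<forall>v. (\<Sum>e\<in>incident_edges E v. f e) \<le> 1)"

definition fractional_matching_number :: "'v::finite set set \<Rightarrow> real" where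
  "fractional_matching_number E =
     (GREATEST x. \<exists>f. fractional_matching E f \<and> x = (\<Sum>e\<in>E. f e))"

text \<open>The last case is intended for \<open>a > 1\<close> only: negative \<open>a\<close> are of no interest.\<close>

definition phi :: "real \<Rightarrow> nat \<Rightarrow> nat \<Rightarrow> real \<Rightarrow> real" where
  "phi a n \<delta> k =
     (if a = 0 then \<delta> * sqrt (1 + 2 * k / (n - k))
      else if 0 < a \<and> a \<le> 1 then 2 * a * \<delta> * n / (n - k)
      else a * \<delta> * (n + k) / (n - k))"

lemma symmetric_eigenvalues:
  fixes M :: "real ^ 'n ^ 'n"
  assumes sym: "transpose M = M"
  shows "finite {c. eigenvalue M c}" and "{c. eigenvalue M c} \<noteq> {}"
proof -
  have sa: "x \<bullet> (M *v y) = (M *v x) \<bullet> y" for x y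
    by (metis dot_lmul_matrix sym transpose_matrix_vector)
  define w where "w c = (SOME x. x \<noteq> 0 \<and> M *v x = c *\<^sub>R x)" for c
  have w: "w c \<noteq> 0 \<and> M *v w c = c *\<^sub>R w c" if "eigenvalue M c" for c
    using that unfolding w_def eigenvalue_def by (rule someI_ex)
  have orth: "w c \<bullet> w d = 0" if "eigenvalue M c" "eigenvalue M d" "c \<noteq> d" for c d
  proof -
    have "d * (w c \<bullet> w d) = c * (w c \<bullet> w d)"
      using sa[of "w c" "w d"] w that by simp
    then show ?thesis using that by simp
  qed
  have inj: "inj_on w {c. eigenvalue M c}"
    using orth w by (metis (mono_tags, lifting) inj_onI inner_eq_zero_iff mem_Collect_eq)
  have "pairwise orthogonal (w ` {c. eigenvalue M c})"
    unfolding pairwise_def orthogonal_def using orth by force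
  then have "independent (w ` {c. eigenvalue M c})"
    by (rule pairwise_orthogonal_independent) (use w in force)
  then show "finite {c. eigenvalue M c}"
    using inj by (metis finite_imageD independent_imp_finite)

  have "continuous_on (sphere 0 1) (\<lambda>x. x \<bullet> (M *v x))"
    by (intro continuous_intros matrix_vector_mult_linear_continuous_on)
  then obtain u where u: "norm u = 1"
    and mx: "\<And>y. norm y = 1 \<Longrightarrow> y \<bullet> (M *v y) \<le> u \<bullet> (M *v u)"
    using continuous_attains_sup[of "sphere (0::real^'n) 1" "\<lambda>x. x \<bullet> (M *v x)"] by auto
  define c where "c = u \<bullet> (M *v u)"
  have ray: "y \<bullet> (M *v y) \<le> c * (y \<bullet> y)" for y
  proof (cases "y = 0")
    case False
    have "(inverse (norm y) *\<^sub>R y) \<bullet> (M *v (inverse (norm y) *\<^sub>R y)) \<le> c"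
      unfolding c_def by (rule mx) (use False in simp)
    then show ?thesis using False
      by (simp add: matrix_vector_mult_scaleR field_simps dot_square_norm power2_eq_square)
  qed simp
  define h where "h = c *\<^sub>R u - M *v u"
  define q where "q = c * (h \<bullet> h) - h \<bullet> (M *v h)"
  have quad: "0 \<le> 2 * t * (h \<bullet> h) + t\<^sup>2 * q" for t
  proof -
    have "c * ((u + t *\<^sub>R h) \<bullet> (u + t *\<^sub>R h)) - (u + t *\<^sub>R h) \<bullet> (M *v (u + t *\<^sub>R h))
        = (c * (u \<bullet> u) - u \<bullet> (M *v u)) + 2 * t * (c * (u \<bullet> h) - (M *v u) \<bullet> h) + t\<^sup>2 * q"
      using sa[of u h]
      by (simp add: q_def matrix_vector_right_distrib matrix_vector_mult_scaleR inner_add_left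
          inner_add_right inner_commute algebra_simps power2_eq_square)
    moreover have "c * (u \<bullet> h) - (M *v u) \<bullet> h = h \<bullet> h"
      by (simp add: h_def inner_diff_left)
    moreover have "c * (u \<bullet> u) - u \<bullet> (M *v u) = 0"
      using u by (simp add: c_def dot_square_norm)
    ultimately show ?thesis using ray[of "u + t *\<^sub>R h"] by simp
  qed
  have "h \<bullet> h = 0"
  proof (rule ccontr)
    assume "h \<bullet> h \<noteq> 0"
    then have p: "h \<bullet> h > 0" by simp
    have q: "q \<ge> 0" unfolding q_def using ray[of h] by simp
    define t where "t = - (h \<bullet> h) / (q + 1)"
    have "2 * t * (h \<bullet> h) + t\<^sup>2 * q = t * (2 * (h \<bullet> h) + t * q)"
      by (simp add: algebra_simps power2_eq_square)
    moreover have "t < 0" using p q by (simp add: t_def field_simps)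
    moreover have "2 * (h \<bullet> h) + t * q > 0"
    proof -
      have "- (t * q) \<le> h \<bullet> h" using p q by (simp add: t_def field_simps)
      then show ?thesis using p by linarith
    qed
    ultimately show False using quad[of t] by (metis mult_neg_pos not_less)
  qed
  then have "eigenvalue M c"
    unfolding eigenvalue_def using u by (intro exI[of _ u]) (auto simp: h_def)
  then show "{c. eigenvalue M c} \<noteq> {}" by auto
qed

lemma fractional_matching_number_attained:
  fixes E :: "'v::finite set set"
  shows "\<exists>f. fractional_matching E f \<and> fractional_matching_number E = (\<Sum>e\<in>E. f e)"
    and "fractional_matching E f \<Longrightarrow> (\<Sum>e\<in>E. f e) \<le> fractional_matching_number E"
proof -
  define B :: "('v set \<Rightarrow> real) set" where "B = PiE UNIV (\<lambda>_. {0..1})"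
  define K where "K = B \<inter> (\<Inter>v. {f. (\<Sum>e\<in>incident_edges E v. f e) \<le> 1})"
  have "compactin (product_topology (\<lambda>_. euclidean) UNIV) B"
    unfolding B_def by (subst compactin_PiE) auto
  then have "compact B"
    by (simp add: euclidean_product_topology)
  moreover have "closed (\<Inter>v. {f::'v set \<Rightarrow> real. (\<Sum>e\<in>incident_edges E v. f e) \<le> 1})"
    by (intro closed_INT ballI closed_Collect_le continuous_intros) auto
  ultimately have "compact K" unfolding K_def by (rule compact_Int_closed)
  moreover have "(\<lambda>_. 0) \<in> K" by (auto simp: K_def B_def)
  moreover have "continuous_on K (\<lambda>f. \<Sum>e\<in>E. f e)"
    by (intro continuous_intros) (auto intro: continuous_on_subset[of UNIV])
  ultimately obtain g where g: "g \<in> K" "\<And>f. f \<in> K \<Longrightarrow> (\<Sum>e\<in>E. f e) \<le> (\<Sum>e\<in>E. g e)"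
    using continuous_attains_sup[of K "\<lambda>f. \<Sum>e\<in>E. f e"] by blast
  have gm: "fractional_matching E g"
    using g(1) by (auto simp: fractional_matching_def K_def B_def PiE_def Pi_def)
  have le: "(\<Sum>e\<in>E. f e) \<le> (\<Sum>e\<in>E. g e)" if "fractional_matching E f" for f
  proof -
    define f' where "f' e = (if e \<in> E then f e else 0)" for e
    have "(\<Sum>e\<in>incident_edges E v. f' e) = (\<Sum>e\<in>incident_edges E v. f e)" for v
      by (rule sum.cong) (auto simp: f'_def incident_edges_def)
    then have "f' \<in> K"
      using that by (auto simp: fractional_matching_def K_def B_def f'_def)
    moreover have "(\<Sum>e\<in>E. f' e) = (\<Sum>e\<in>E. f e)"
      by (rule sum.cong) (auto simp: f'_def)
    ultimately show ?thesis using g(2)[of f'] by simp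
  qed
  have eq: "fractional_matching_number E = (\<Sum>e\<in>E. g e)"
    unfolding fractional_matching_number_def
    by (rule Greatest_equality) (use gm le in auto)
  show "\<exists>f. fractional_matching E f \<and> fractional_matching_number E = (\<Sum>e\<in>E. f e)"
    using gm eq by blast
  show "fractional_matching E f \<Longrightarrow> (\<Sum>e\<in>E. f e) \<le> fractional_matching_number E"
    using le eq by simp
qed

end

theory Submission
  imports Defs
begin

text \<open>
  If \<open>\<mu>\<^sub>f \<le> (n - k) / 2\<close>, then some independent set \<open>T\<close> with neighbourhood \<open>S\<close> satisfies
  \<open>|T| \<ge> |S| + k\<close>: otherwise the deficiency version of Hall's theorem, applied to the bipartite
  double cover, gives a matching of the cover with more than \<open>n - k\<close> edges, and half of it projects
  to a fractional matching. At least \<open>\<delta> |T|\<close> edges join \<open>S\<close> and \<open>T\<close>, so the Rayleigh quotient of a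
  vector that is constant \<open>p\<close> on \<open>S\<close>, constant \<open>q\<close> on \<open>T\<close> and zero elsewhere bounds
  \<open>\<lambda>\<^sub>1\<close> from below. The three cases of \<open>\<phi>\<close> come from \<open>(p, q)\<close> equal to
  \<open>(\<surd>|T|, \<surd>|S|)\<close>, \<open>(|T|, |S|)\<close> and \<open>(1, 0)\<close>, together with
  \<open>|T| / |S| \<ge> 1 + 2k / (n - k)\<close>, which holds because \<open>2|S| + k \<le> n\<close>.
\<close>

section \<open>Hall's theorem with deficiency\<close>

text \<open>
  Rado's argument: as \<open>card (\<Union>(A ` T))\<close> is submodular in \<open>T\<close>, of any two elements of a set \<open>A x\<close>
  one can be removed without violating the Hall condition, so that all sets shrink to at most one
  element.
\<close>

lemma hall_deficiency:
  fixes A :: "'a \<Rightarrow> 'b set"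
  assumes "finite I" "\<And>x. x \<in> I \<Longrightarrow> finite (A x)"
    and "\<And>T. T \<subseteq> I \<Longrightarrow> card T \<le> card (\<Union>(A ` T)) + d"
  shows "\<exists>W g. g ` W \<subseteq> I \<and> inj_on g W \<and> (\<forall>y\<in>W. y \<in> A (g y)) \<and> card I \<le> card W + d"
  using assms
proof (induction "\<Sum>x\<in>I. card (A x)" arbitrary: A rule: less_induct)
  case less
  note fin = less.prems(2) and hall = less.prems(3)
  show ?case
  proof (cases "\<exists>x\<in>I. card (A x) \<ge> 2")
    case False
    \<comment> \<open>When every set has at most one element, any choice of \<open>g\<close> is
      injective, and the Hall condition for \<open>I\<close> itself bounds
      \<open>card W\<close>.\<close>
    define W where "W = \<Union>(A ` I)"
    have "\<exists>x. x \<in> I \<and> y \<in> A x" if "y \<in> W" for y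
      using that by (auto simp: W_def)
    then obtain g where g: "\<And>y. y \<in> W \<Longrightarrow> g y \<in> I \<and> y \<in> A (g y)"
      by metis
    have "inj_on g W"
    proof (rule inj_onI)
      fix y z assume yz: "y \<in> W" "z \<in> W" "g y = g z"
      have "card (A (g y)) \<le> Suc 0" using False g[OF yz(1)] by fastforce
      then show "y = z"
        using g yz fin card_le_Suc0_iff_eq[of "A (g y)"] by metis
    qed
    then show ?thesis using g hall[of I] unfolding W_def by blast
  next
    case True
    then obtain x where x: "x \<in> I" "card (A x) \<ge> 2" by blast
    then obtain y1 y2 where y: "y1 \<in> A x" "y2 \<in> A x" "y1 \<noteq> y2"
      by (metis card_le_Suc0_iff_eq card.infinite not_less_eq_eq numeral_2_eq_2 fin)
    define B where "B y = A(x := A x - {y})" for y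
    have "\<exists>y\<in>{y1, y2}. \<forall>T\<subseteq>I. card T \<le> card (\<Union>(B y ` T)) + d"
    proof (rule ccontr)
      assume "\<not> ?thesis"
      then obtain S1 S2 where S: "S1 \<subseteq> I" "S2 \<subseteq> I"
        "card S1 > card (\<Union>(B y1 ` S1)) + d" "card S2 > card (\<Union>(B y2 ` S2)) + d"
        by (auto simp: not_le)
      have xS: "x \<in> S" if "card S > card (\<Union>(B y ` S)) + d" "S \<subseteq> I" for S y
      proof (rule ccontr)
        assume "x \<notin> S"
        then have "B y ` S = A ` S" by (auto simp: B_def)
        then show False using that hall[of S] by simp
      qed
      have x12: "x \<in> S1" "x \<in> S2" using xS S by blast+
      define X where "X = \<Union>(B y1 ` S1)"
      define Y where "Y = \<Union>(B y2 ` S2)"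
      have finS: "finite S1" "finite S2" using S less.prems(1) finite_subset by blast+
      have "finite (B y z)" if "z \<in> I" for y z using fin[OF that] fin[OF x(1)] by (simp add: B_def)
      then have finXY: "finite X" "finite Y" using S finS unfolding X_def Y_def by blast+
      \<comment> \<open>As \<open>y1\<close> and \<open>y2\<close> differ, \<open>A x - {y1}\<close>
        and \<open>A x - {y2}\<close> together cover \<open>A x\<close>.\<close>
      have "A x \<subseteq> X \<union> Y" using x12 y(3) by (auto simp: X_def Y_def B_def)
      then have "\<Union>(A ` (S1 \<union> S2)) \<subseteq> X \<union> Y"
        unfolding X_def Y_def B_def by fastforce
      then have un: "card (\<Union>(A ` (S1 \<union> S2))) \<le> card (X \<union> Y)"
        using finXY by (intro card_mono) auto
      \<comment> \<open>\<open>A x\<close> need not lie in \<open>X \<inter> Y\<close>, so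
        \<open>x\<close> is dropped from the intersection. This costs one, while the two strict
        violations gain two; hence the contradiction.\<close>
      have "\<Union>(A ` (S1 \<inter> S2 - {x})) \<subseteq> X \<inter> Y"
        unfolding X_def Y_def B_def by fastforce
      then have int: "card (\<Union>(A ` (S1 \<inter> S2 - {x}))) \<le> card (X \<inter> Y)"
        using finXY by (intro card_mono) auto
      have "card (S1 \<union> S2) \<le> card (X \<union> Y) + d"
        using hall[of "S1 \<union> S2"] S un by force
      moreover have "card (S1 \<inter> S2 - {x}) \<le> card (X \<inter> Y) + d"
        using hall[of "S1 \<inter> S2 - {x}"] S int by force
      moreover have "card (S1 \<inter> S2) = Suc (card (S1 \<inter> S2 - {x}))"
        using x12 finS by (intro card.remove) auto
      moreover have "card S1 + card S2 = card (S1 \<union> S2) + card (S1 \<inter> S2)"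
        using finS by (rule card_Un_Int)
      moreover have "card X + card Y = card (X \<union> Y) + card (X \<inter> Y)"
        using finXY by (rule card_Un_Int)
      ultimately show False using S(3,4) unfolding X_def[symmetric] Y_def[symmetric] by linarith
    qed
    then obtain y where y': "y \<in> A x" "\<And>T. T \<subseteq> I \<Longrightarrow> card T \<le> card (\<Union>(B y ` T)) + d"
      using y by blast
    have sub: "B y z \<subseteq> A z" for z by (auto simp: B_def)
    have finB: "finite (B y z)" if "z \<in> I" for z using fin[OF that] sub finite_subset by blast
    have "(\<Sum>z\<in>I. card (B y z)) < (\<Sum>z\<in>I. card (A z))"
    proof (rule sum_strict_mono_ex1)
      show "\<forall>z\<in>I. card (B y z) \<le> card (A z)" using sub fin by (simp add: card_mono)
      have "card (B y x) < card (A x)"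
        using card_Diff1_less[OF fin[OF x(1)] y'(1)] by (simp only: B_def fun_upd_same)
      then show "\<exists>z\<in>I. card (B y z) < card (A z)" using x(1) by blast
    qed (rule less.prems(1))
    from less.hyps[OF this less.prems(1) finB y'(2)] sub show ?thesis by blast
  qed
qed

section \<open>Fractional matchings and the bipartite double cover\<close>

text \<open>The pairs \<open>(w, g w)\<close> form a matching of the double cover. Weight 1/2 for
  each is feasible: an edge is used at most once from each end, and a vertex occurs at most once as
  \<open>w\<close> and, by injectivity, at most once as \<open>g w\<close>.\<close>

lemma half_matching_le_fractional_matching_number:
  fixes E :: "'v::finite set set"
  assumes E: "simple_graph E" and inj: "inj_on g W"
    and adj: "\<And>w. w \<in> W \<Longrightarrow> adjacent E w (g w)"
  shows "real (card W) / 2 \<le> fractional_matching_number E"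
proof -
  define f where "f e = real (card {w\<in>W. {w, g w} = e}) / 2" for e
  have sum_f: "(\<Sum>e\<in>F. f e) = real (card {w\<in>W. {w, g w} \<in> F}) / 2" for F
  proof -
    have "(\<Sum>e\<in>F. card {w\<in>W. {w, g w} = e})
        = (\<Sum>e\<in>F. \<Sum>w\<in>{w\<in>{w\<in>W. {w, g w} \<in> F}. {w, g w} = e}. 1)"
      by (intro sum.cong refl) (auto intro: arg_cong[of _ _ card])
    also have "\<dots> = (\<Sum>w\<in>{w\<in>W. {w, g w} \<in> F}. 1)"
      by (rule sum.group) auto
    finally show ?thesis
      by (simp add: f_def flip: sum_divide_distrib of_nat_sum)
  qed
  have "f e \<le> 1" if "e \<in> E" for e
  proof -
    have "card {w\<in>W. {w, g w} = e} \<le> card e" by (intro card_mono) auto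
    then show ?thesis using E that by (simp add: f_def simple_graph_def)
  qed
  moreover have "(\<Sum>e\<in>incident_edges E v. f e) \<le> 1" for v
  proof -
    have "card {w\<in>W. {w, g w} \<in> incident_edges E v} \<le> card (insert v {w\<in>W. g w = v})"
      by (intro card_mono) (auto simp: incident_edges_def)
    also have "\<dots> \<le> Suc (card {w\<in>W. g w = v})" by (simp add: card_insert_if)
    also have "card {w\<in>W. g w = v} \<le> Suc 0"
      using inj by (subst card_le_Suc0_iff_eq) (auto simp: inj_on_def)
    finally show ?thesis by (simp add: sum_f)
  qed
  ultimately have "fractional_matching E f"
    by (simp add: fractional_matching_def f_def)
  moreover have "{w\<in>W. {w, g w} \<in> E} = W" using adj by (auto simp: adjacent_def)
  ultimately show ?thesis
    using fractional_matching_number_attained(2)[of E f] by (simp add: sum_f)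
qed

text \<open>Members of \<open>T\<close> are kept, so this is the neighbourhood in the double cover,
  and its disjointness from \<open>T\<close> says that \<open>T\<close> is independent.\<close>

definition neighbours :: "'v::finite set set \<Rightarrow> 'v set \<Rightarrow> 'v set" where
  "neighbours E T = {u. \<exists>v\<in>T. adjacent E u v}"

lemma adjacent_commute: "adjacent E u v \<longleftrightarrow> adjacent E v u"
  by (simp add: adjacent_def insert_commute)

text \<open>
  A half of the fractional Tutte--Berge formula: as \<open>T\<close> is disjoint from its neighbourhood, it
  consists of isolated vertices of the graph without \<open>neighbours E T\<close>.
\<close>

lemma fractional_tutte_berge:
  fixes E :: "'v::finite set set"
  assumes E: "simple_graph E" and k: "0 < k"
    and le: "fractional_matching_number E \<le> (real CARD('v) - k) / 2"
  obtains T where "T \<inter> neighbours E T = {}" "real (card (neighbours E T)) + k \<le> real (card T)"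
proof -
  have "\<exists>T. real (card (neighbours E T)) + k \<le> real (card T)"
  proof (rule ccontr)
    assume "\<not> ?thesis"
    then have lt: "real (card T) < real (card (neighbours E T)) + k" for T
      by (meson not_le)
    \<comment> \<open>The largest integer below \<open>k\<close>: an integral deficiency less than
      \<open>k\<close> is at most \<open>d\<close>.\<close>
    define d where "d = nat (\<lceil>k\<rceil> - 1)"
    have dk: "real d < k" using k by (simp add: d_def) linarith
    have "card T \<le> card (\<Union>((\<lambda>v. neighbours E {v}) ` T)) + d" for T
    proof -
      have "(\<Union>((\<lambda>v. neighbours E {v}) ` T)) = neighbours E T"
        by (auto simp: neighbours_def)
      moreover have "int (card T) - int (card (neighbours E T)) < \<lceil>k\<rceil>"
        using lt[of T] by (simp add: less_ceiling_iff)
      ultimately show ?thesis by (simp add: d_def)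
    qed
    then obtain W g where "inj_on g W" "\<forall>w\<in>W. w \<in> neighbours E {g w}"
      and c: "CARD('v) \<le> card W + d"
      using hall_deficiency[of "UNIV :: 'v set" "\<lambda>v. neighbours E {v}" d] by auto
    then have "real (card W) / 2 \<le> fractional_matching_number E"
      using E by (intro half_matching_le_fractional_matching_number) (auto simp: neighbours_def)
    moreover have "real CARD('v) \<le> real (card W) + real d" using c by linarith
    ultimately show False using le dk by argo
  qed
  then obtain T where T: "real (card (neighbours E T)) + k \<le> real (card T)" ..
  \<comment> \<open>Passing to \<open>T - N\<close> makes the set independent and keeps the
    deficiency: a neighbour inside \<open>T\<close> would put a vertex of \<open>T - N\<close> into
    \<open>N\<close>, so both cardinalities drop by at least \<open>card (N \<inter> T)\<close>,
    that of \<open>T\<close> by exactly this.\<close>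
  define N where "N = neighbours E T"
  have N': "neighbours E (T - N) \<subseteq> N - T"
    unfolding N_def neighbours_def using adjacent_commute[of E] by blast
  then have "(T - N) \<inter> neighbours E (T - N) = {}" by blast
  moreover have "card (neighbours E (T - N)) \<le> card (N - T)"
    using N' by (intro card_mono) auto
  moreover have "card (N - T) + card (N \<inter> T) = card N" "card (T - N) + card (N \<inter> T) = card T"
    using card_Int_Diff[of N T] card_Int_Diff[of T N] by (auto simp: Int_commute)
  ultimately show ?thesis using T unfolding N_def[symmetric] by (intro that[of "T - N"]) linarith+
qed

section \<open>Rayleigh quotients and the quadratic form\<close>

text \<open>The form attains its maximum \<open>c\<close> on the unit sphere at an eigenvector for
  \<open>c\<close>, so \<open>c\<close> is at most the largest eigenvalue.\<close>

lemma rayleigh_le_largest_eigenvalue: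
  fixes M :: "real ^ 'n ^ 'n"
  assumes sym: "transpose M = M"
  shows "x \<bullet> (M *v x) \<le> largest_eigenvalue M * (x \<bullet> x)"
proof -
  have sa: "y \<bullet> (M *v z) = z \<bullet> (M *v y)" for y z
    by (metis dot_lmul_matrix sym transpose_matrix_vector inner_commute)
  have "continuous_on (sphere 0 1) (\<lambda>x. x \<bullet> (M *v x))"
    by (intro continuous_intros matrix_vector_mult_linear_continuous_on)
  then obtain u where u: "norm u = 1"
    and mx: "\<And>y. norm y = 1 \<Longrightarrow> y \<bullet> (M *v y) \<le> u \<bullet> (M *v u)"
    using continuous_attains_sup[of "sphere (0::real^'n) 1" "\<lambda>x. x \<bullet> (M *v x)"] by auto
  define c where "c = u \<bullet> (M *v u)"
  have ray: "y \<bullet> (M *v y) \<le> c * (y \<bullet> y)" for y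
  proof (cases "y = 0")
    case False
    have "(inverse (norm y) *\<^sub>R y) \<bullet> (M *v (inverse (norm y) *\<^sub>R y)) \<le> c"
      unfolding c_def by (rule mx) (use False in simp)
    then show ?thesis using False
      by (simp add: matrix_vector_mult_scaleR field_simps dot_square_norm power2_eq_square)
  qed simp
  \<comment> \<open>First-order condition at the maximiser: a quadratic in \<open>t\<close> with
    linear coefficient \<open>2 * b\<close> and no constant term stays nonnegative, so
    \<open>b = 0\<close>. The test value \<open>- b / (q + 1)\<close> also covers
    \<open>q = 0\<close>.\<close>
  have "(c *\<^sub>R u - M *v u) \<bullet> h = 0" for h
  proof -
    define b where "b = (c *\<^sub>R u - M *v u) \<bullet> h"
    define q where "q = c * (h \<bullet> h) - h \<bullet> (M *v h)"
    have q0: "q \<ge> 0" using ray[of h] by (simp add: q_def)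
    have quad: "0 \<le> 2 * t * b + t\<^sup>2 * q" for t
    proof -
      have "c * ((u + t *\<^sub>R h) \<bullet> (u + t *\<^sub>R h)) - (u + t *\<^sub>R h) \<bullet> (M *v (u + t *\<^sub>R h))
          = (c * (u \<bullet> u) - u \<bullet> (M *v u)) + 2 * t * b + t\<^sup>2 * q"
        using sa[of u h]
        by (simp add: q_def b_def matrix_vector_right_distrib matrix_vector_mult_scaleR
            inner_add_left inner_add_right inner_diff_left inner_commute algebra_simps power2_eq_square)
      moreover have "c * (u \<bullet> u) - u \<bullet> (M *v u) = 0"
        using u by (simp add: c_def dot_square_norm)
      ultimately show ?thesis using ray[of "u + t *\<^sub>R h"] by simp
    qed
    have "2 * (- b / (q + 1)) * b + (- b / (q + 1))\<^sup>2 * q = - (b\<^sup>2 * (q + 2) / (q + 1)\<^sup>2)"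
    proof -
      define m where "m = q + 1"
      have m: "m > 0" "q = m - 1" using q0 by (auto simp: m_def)
      show ?thesis unfolding m(2) using m(1) by (simp add: field_simps power2_eq_square)
    qed
    then have "b\<^sup>2 * (q + 2) / (q + 1)\<^sup>2 \<le> 0" using quad[of "- b / (q + 1)"] by linarith
    then show ?thesis using q0 by (simp add: b_def[symmetric] divide_le_0_iff mult_le_0_iff)
  qed
  then have "M *v u = c *\<^sub>R u" by (metis inner_eq_zero_iff right_minus_eq)
  then have "eigenvalue M c" using u unfolding eigenvalue_def by (intro exI[of _ u]) auto
  then have "c \<le> largest_eigenvalue M"
    unfolding largest_eigenvalue_def using symmetric_eigenvalues(1)[OF sym] by (intro Max_ge) auto
  then show ?thesis using ray[of x] mult_right_mono[OF _ inner_ge_zero] by (meson order_trans)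
qed

lemma degree_eq_card_adjacent:
  fixes E :: "'v::finite set set"
  assumes "simple_graph E"
  shows "degree E v = card {u. adjacent E u v}"
proof -
  have "incident_edges E v = (\<lambda>u. {u, v}) ` {u. adjacent E u v}"
  proof (intro equalityI subsetI)
    fix e assume "e \<in> incident_edges E v"
    then have "card e = 2" "v \<in> e" "e \<in> E"
      using assms by (auto simp: simple_graph_def incident_edges_def)
    then show "e \<in> (\<lambda>u. {u, v}) ` {u. adjacent E u v}"
      by (auto simp: card_2_iff adjacent_def insert_commute)
  qed (auto simp: incident_edges_def adjacent_def)
  moreover have "inj_on (\<lambda>u. {u, v}) {u. adjacent E u v}"
    by (auto simp: inj_on_def doubleton_eq_iff)
  ultimately show ?thesis by (simp add: degree_def card_image)
qed

text \<open>Ordered pairs spread the degree of \<open>v\<close> over the pairs ending in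
  \<open>v\<close>; lower bounds then follow by dropping nonnegative terms.\<close>

lemma quadratic_form:
  fixes E :: "'v::finite set set"
  assumes "simple_graph E"
  shows "x \<bullet> ((a *\<^sub>R degree_matrix E + adjacency_matrix E) *v x)
      = (\<Sum>(u, v)\<in>{(u, v). adjacent E u v}. a * (x $ v)\<^sup>2 + x $ u * x $ v)"
proof -
  have "x \<bullet> ((a *\<^sub>R degree_matrix E + adjacency_matrix E) *v x)
      = (\<Sum>v\<in>UNIV. \<Sum>u\<in>UNIV. if adjacent E u v then a * (x $ v)\<^sup>2 + x $ u * x $ v else 0)"
    unfolding inner_vec_def
  proof (rule sum.cong)
    fix v :: 'v
    have "((a *\<^sub>R degree_matrix E + adjacency_matrix E) *v x) $ v
        = (\<Sum>u\<in>UNIV. if u = v then a * real (degree E v) * x $ v else 0)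
          + (\<Sum>u\<in>UNIV. if adjacent E u v then x $ u else 0)"
      unfolding sum.distrib[symmetric]
      by (auto simp: matrix_vector_mult_def degree_matrix_def adjacency_matrix_def adjacent_commute
          algebra_simps intro!: sum.cong)
    also have "\<dots> = a * real (degree E v) * x $ v + (\<Sum>u | adjacent E u v. x $ u)"
      by (simp add: sum.If_cases)
    finally show "x $ v \<bullet> ((a *\<^sub>R degree_matrix E + adjacency_matrix E) *v x) $ v
        = (\<Sum>u\<in>UNIV. if adjacent E u v then a * (x $ v)\<^sup>2 + x $ u * x $ v else 0)"
      by (simp add: degree_eq_card_adjacent[OF assms] sum.If_cases sum.distrib sum_distrib_left
          power2_eq_square algebra_simps)
  qed simp
  also have "\<dots> = (\<Sum>(u, v)\<in>UNIV. if adjacent E u v then a * (x $ v)\<^sup>2 + x $ u * x $ v else 0)"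
    by (subst sum.swap) (simp add: sum.cartesian_product)
  also have "\<dots> = (\<Sum>(u, v)\<in>{(u, v). adjacent E u v}. a * (x $ v)\<^sup>2 + x $ u * x $ v)"
    by (rule sum.mono_neutral_cong_right) (auto split: if_splits)
  finally show ?thesis .
qed

lemma largest_eigenvalue_ge:
  fixes E :: "'v::finite set set" and a p q :: real
  assumes E: "simple_graph E" and "a \<ge> 0" "p \<ge> 0" "q \<ge> 0"
    and T: "T \<inter> neighbours E T = {}"
  shows "real (min_degree E) * card T * (a * p\<^sup>2 + a * q\<^sup>2 + 2 * p * q)
    \<le> largest_eigenvalue (a *\<^sub>R degree_matrix E + adjacency_matrix E)
        * (card (neighbours E T) * p\<^sup>2 + card T * q\<^sup>2)"
proof -
  define S where "S = neighbours E T"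
  have disj: "S \<inter> T = {}" using T by (auto simp: S_def)
  define x :: "real ^ 'v" where "x = (\<chi> v. if v \<in> S then p else if v \<in> T then q else 0)"
  have xS: "x $ v = p" if "v \<in> S" for v using that by (simp add: x_def)
  have xT: "x $ v = q" if "v \<in> T" for v using that disj by (auto simp: x_def)
  have x0: "x $ v \<ge> 0" for v using assms by (simp add: x_def)
  \<comment> \<open>The edges between \<open>S\<close> and \<open>T\<close>, directed towards
    \<open>T\<close>; each vertex of \<open>T\<close> receives at least \<open>min_degree E\<close>
    of them.\<close>
  define F where "F = {(u, v). adjacent E u v \<and> v \<in> T}"
  have F: "u \<in> S" "v \<in> T" if "(u, v) \<in> F" for u v
    using that by (auto simp: F_def S_def neighbours_def)
  let ?M = "a *\<^sub>R degree_matrix E + adjacency_matrix E"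
  let ?h = "\<lambda>(u, v). a * (x $ v)\<^sup>2 + x $ u * x $ v"
  have "F = (\<Union>v\<in>T. {u. adjacent E u v} \<times> {v})" by (auto simp: F_def)
  then have "card F = (\<Sum>v\<in>T. card ({u. adjacent E u v} \<times> {v}))"
    by (simp only:) (rule card_UN_disjoint, auto)
  also have "\<dots> = (\<Sum>v\<in>T. degree E v)"
    by (simp add: degree_eq_card_adjacent[OF E] card_cartesian_product)
  finally have "card F \<ge> (\<Sum>v\<in>T. min_degree E)"
    by (simp add: min_degree_def sum_mono del: sum_constant)
  then have "real (min_degree E) * card T \<le> card F"
    by (simp add: mult.commute flip: of_nat_mult)
  then have "real (min_degree E) * card T * (a * p\<^sup>2 + a * q\<^sup>2 + 2 * p * q)
      \<le> card F * (a * p\<^sup>2 + a * q\<^sup>2 + 2 * p * q)"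
    using assms by (intro mult_right_mono) auto
  \<comment> \<open>One edge contributes \<open>a * q\<^sup>2 + p * q\<close> in the direction of
    \<open>T\<close> and \<open>a * p\<^sup>2 + p * q\<close> in the other.\<close>
  also have "\<dots> = (\<Sum>e\<in>F. ?h e) + (\<Sum>e\<in>F. ?h (prod.swap e))"
  proof -
    have "(\<Sum>e\<in>F. ?h e + ?h (prod.swap e)) = (\<Sum>e\<in>F. a * p\<^sup>2 + a * q\<^sup>2 + 2 * p * q)"
      using F xS xT by (intro sum.cong) auto
    then show ?thesis by (simp add: sum.distrib)
  qed
  also have "(\<Sum>e\<in>F. ?h (prod.swap e)) = (\<Sum>e\<in>prod.swap ` F. ?h e)"
    by (simp add: sum.reindex)
  also have "(\<Sum>e\<in>F. ?h e) + (\<Sum>e\<in>prod.swap ` F. ?h e) = (\<Sum>e\<in>F \<union> prod.swap ` F. ?h e)"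
    using F disj by (intro sum.union_disjoint[symmetric]) fastforce+
  also have "\<dots> \<le> (\<Sum>e\<in>{(u, v). adjacent E u v}. ?h e)"
    using assms x0 by (intro sum_mono2) (auto simp: F_def adjacent_commute)
  also have "\<dots> = x \<bullet> (?M *v x)"
    by (simp add: quadratic_form[OF E])
  also have "\<dots> \<le> largest_eigenvalue ?M * (x \<bullet> x)"
    by (intro rayleigh_le_largest_eigenvalue)
      (auto simp: transpose_def vec_eq_iff degree_matrix_def adjacency_matrix_def adjacent_commute)
  also have "x \<bullet> x = card S * p\<^sup>2 + card T * q\<^sup>2"
  proof -
    have "x \<bullet> x = (\<Sum>v\<in>S \<union> T. (x $ v)\<^sup>2)"
      unfolding inner_vec_def
      by (rule sum.mono_neutral_cong_right) (auto simp: x_def power2_eq_square)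
    also have "\<dots> = (\<Sum>v\<in>S. (x $ v)\<^sup>2) + (\<Sum>v\<in>T. (x $ v)\<^sup>2)"
      using disj by (intro sum.union_disjoint) auto
    also have "\<dots> = card S * p\<^sup>2 + card T * q\<^sup>2" by (simp add: xS xT)
    finally show ?thesis .
  qed
  finally show ?thesis by (simp add: S_def)
qed

section \<open>Test vectors for the three cases of \<open>phi\<close>\<close>

theorem theorem1p3:
  fixes E :: "'v::finite set set" and a k :: real and n \<delta> :: nat
  assumes "a \<ge> 0"
    and "simple_graph E" and "connected_graph E"
    and "n = CARD('v)" and "\<delta> = min_degree E"
    and "0 < k" and "k < real n"
    and "real \<delta> \<le> (real n - k) / 2"
    and "largest_eigenvalue (a *\<^sub>R degree_matrix E + adjacency_matrix E) < phi a n \<delta> k"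
  shows "fractional_matching_number E > (real n - k) / 2"
proof (rule ccontr)
  assume "\<not> ?thesis"
  then have "fractional_matching_number E \<le> (real CARD('v) - k) / 2" using assms(4) by simp
  then obtain T where disj: "T \<inter> neighbours E T = {}"
    and T: "real (card (neighbours E T)) + k \<le> real (card T)"
    using fractional_tutte_berge assms(2,6) by blast
  define l where "l = largest_eigenvalue (a *\<^sub>R degree_matrix E + adjacency_matrix E)"
  define s where "s = real (card (neighbours E T))"
  define t where "t = real (card T)"
  \<comment> \<open>\<open>r\<close> is \<open>(n + k) / (n - k)\<close> and \<open>r + 1\<close> is
    \<open>2 * n / (n - k)\<close>, so all three cases of \<open>phi\<close> are expressed by
    \<open>r\<close>.\<close>
  define r where "r = 1 + 2 * k / (n - k)"
  have l_ge: "\<delta> * t * (a * p\<^sup>2 + a * q\<^sup>2 + 2 * p * q) \<le> l * (s * p\<^sup>2 + t * q\<^sup>2)"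
    if "p \<ge> 0" "q \<ge> 0" for p q
    using largest_eigenvalue_ge[OF assms(2,1) that disj]
    by (simp add: l_def s_def t_def assms(5))
  have s0: "s \<ge> 0" and t0: "t > 0" using T assms(6) by (auto simp: s_def t_def)
  have lt: "l < phi a n \<delta> k" using assms(9) by (simp add: l_def)
  have "phi a n \<delta> k \<le> l"
  proof (cases "s = 0 \<or> \<delta> = 0")
    case True
    \<comment> \<open>A vertex of \<open>T\<close> has all its neighbours in
      \<open>neighbours E T\<close>, so \<open>s = 0\<close> also forces
      \<open>\<delta> = 0\<close>, and then \<open>phi\<close> vanishes.\<close>
    have "\<delta> \<le> card (neighbours E T)"
    proof -
      from t0 obtain v where "v \<in> T" by (auto simp: t_def card_gt_0_iff)
      have "\<delta> \<le> degree E v" unfolding assms(5) min_degree_def by simp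
      also have "\<dots> \<le> card (neighbours E T)"
        unfolding degree_eq_card_adjacent[OF assms(2)] using \<open>v \<in> T\<close>
        by (intro card_mono) (auto simp: neighbours_def)
      finally show ?thesis .
    qed
    then have "\<delta> = 0" using True by (auto simp: s_def)
    moreover have "0 \<le> l" using l_ge[of 0 1] t0 \<open>\<delta> = 0\<close> by (simp add: zero_le_mult_iff)
    ultimately show ?thesis by (simp add: phi_def)
  next
    case False
    then have s: "s > 0" and d: "\<delta> > 0" using s0 by auto
    have nk: "n - k > 0" using assms(7) by simp
    have "card (neighbours E T \<union> T) \<le> n" unfolding assms(4) by (intro card_mono) auto
    then have "s + t \<le> n" using disj by (simp add: s_def t_def card_Un_disjoint Int_commute)
    then have "2 * s \<le> n - k" using T by (simp add: s_def t_def)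
    then have "2 * s * k \<le> (n - k) * k" using assms(6) by (intro mult_right_mono) auto
    then have "2 * k / (n - k) \<le> k / s" using s nk by (simp add: field_simps)
    also have "\<dots> \<le> (t - s) / s" using T s by (intro divide_right_mono) (auto simp: s_def t_def)
    finally have r: "r \<le> t / s" using s by (simp add: r_def diff_divide_distrib)
    consider "a = 0" | "0 < a" "a \<le> 1" | "a > 1" using assms(1) by linarith
    then show ?thesis
    proof cases
      case 1
      \<comment> \<open>This choice balances the two parts of the squared norm: both equal
        \<open>s * t\<close>.\<close>
      have "\<delta> * t * (2 * sqrt t * sqrt s) \<le> l * (s * t + t * s)"
        using l_ge[of "sqrt t" "sqrt s"] s t0 1 by simp
      then have "(\<delta> * (sqrt t * sqrt s)) * (2 * t) \<le> (l * s) * (2 * t)"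
        by (simp add: algebra_simps)
      then have "\<delta> * (sqrt t * sqrt s) \<le> l * s" using t0 by simp
      then have "\<delta> * (sqrt t * sqrt s) / s \<le> l" using s by (simp add: field_simps)
      moreover have "sqrt t * sqrt s / s = sqrt (t / s)"
        using s by (simp add: real_sqrt_divide field_simps)
      moreover have "\<delta> * sqrt r \<le> \<delta> * sqrt (t / s)"
        using r by (intro mult_left_mono) auto
      ultimately have "\<delta> * sqrt r \<le> l" by (metis order_trans times_divide_eq_right)
      then show ?thesis using 1 by (simp add: phi_def r_def)
    next
      case 2
      \<comment> \<open>For \<open>a \<le> 1\<close> the cross term is at least \<open>a\<close>
        times itself, which completes the square; the norm also factors, as
        \<open>s * t * (t + s)\<close>.\<close>
      have "a * (2 * s * t) \<le> 2 * s * t" using 2 s t0 by (simp add: mult_left_le_one_le)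
      then have "a * (t + s)\<^sup>2 \<le> a * t\<^sup>2 + a * s\<^sup>2 + 2 * t * s"
        by (simp add: power2_eq_square algebra_simps)
      then have "\<delta> * t * (a * (t + s)\<^sup>2) \<le> \<delta> * t * (a * t\<^sup>2 + a * s\<^sup>2 + 2 * t * s)"
        using t0 by (intro mult_left_mono) auto
      also have "\<dots> \<le> l * (s * t\<^sup>2 + t * s\<^sup>2)" using s t0 by (intro l_ge) auto
      finally have "(\<delta> * a * (t + s)) * (t * (t + s)) \<le> (l * s) * (t * (t + s))"
        by (simp add: algebra_simps power2_eq_square)
      then have "\<delta> * a * (t + s) \<le> l * s"
        using s t0 by (metis add_pos_pos mult_le_cancel_right_pos mult_pos_pos)
      then have "\<delta> * a * (t / s + 1) \<le> l" using s by (simp add: field_simps)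
      moreover have "\<delta> * a * (r + 1) \<le> \<delta> * a * (t / s + 1)"
        using r 2 by (intro mult_left_mono) auto
      moreover have "phi a n \<delta> k = \<delta> * a * (r + 1)"
        using 2 nk by (simp add: phi_def r_def field_simps)
      ultimately show ?thesis by linarith
    next
      case 3
      \<comment> \<open>The vector supported on the neighbourhood alone uses only the degree
        terms.\<close>
      have "\<delta> * t * a \<le> l * s" using l_ge[of 1 0] by simp
      then have "\<delta> * a * (t / s) \<le> l" using s by (simp add: field_simps)
      moreover have "\<delta> * a * r \<le> \<delta> * a * (t / s)"
        using r 3 by (intro mult_left_mono) auto
      moreover have "phi a n \<delta> k = \<delta> * a * r"
        using 3 nk by (simp add: phi_def r_def field_simps)
      ultimately show ?thesis by linarith
    qed
  qed
  then show False using lt by simp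
qed

end
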